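(* Let $\mathfrak{g}$ be a real quasi-filiform Lie algebra admitting a complex structure. Then $\mathfrak{g}$ is isomorphic either to the $4$-dimensional algebra $\mathfrak{L}_3\oplus\mathbb{R}$, with basis $X_0,X_1,X_2,X_3$ and only nonzero brackets $[X_0,X_1]=X_2$ (up to antisymmetry), or to the $6$-dimensional algebra $\mathfrak{n}_{6,3}$, with basis $X_0,\dots,X_5$ and only nonzero brackets (up to antisymmetry) $[X_0,X_i]=X_{i+1}$ for $i=1,2,3$, $[X_1,X_2]=X_5$, $[X_1,X_5]=X_4$.
   Context: Lower central series: $\mathfrak{g}^0=\mathfrak{g}$, $\mathfrak{g}^i=[\mathfrak{g}^{i-1},\mathfrak{g}]$; the nilindex of a nilpotent Lie algebra is the least $m$ with $\mathfrak{g}^m=0$. A nilpotent Lie algebra is quasi-filiform if its nilindex equals $\dim\mathfrak{g}-2$. A complex structure on a real Lie algebra $\mathfrak{g}$ (of even dimension) is a linear endomorphism $J$ with $J^2=-\mathrm{Id}$ and $[JX,JY]-[X,Y]-J[JX,Y]-J[X,JY]=0$ for all $X,Y\in\mathfrak{g}$. *)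

theory Defs
  imports "HOL-Analysis.Analysis"
begin

text \<open>A real finite-dimensional Lie algebra is modelled as a Euclidean space (any finite-dimensional
real vector space) together with a bracket.\<close>

definition lie_algebra :: "('a::euclidean_space \<Rightarrow> 'a \<Rightarrow> 'a) \<Rightarrow> bool" where
  "lie_algebra br \<longleftrightarrow> bilinear br \<and> (\<forall>x. br x x = 0) \<and>
     (\<forall>x y z. br x (br y z) + br y (br z x) + br z (br x y) = 0)"

fun lcs :: "('a::euclidean_space \<Rightarrow> 'a \<Rightarrow> 'a) \<Rightarrow> nat \<Rightarrow> 'a set" where
  "lcs br 0 = UNIV"
| "lcs br (Suc i) = span {br x y | x y. x \<in> lcs br i}"

definition nilpotent_lie :: "('a::euclidean_space \<Rightarrow> 'a \<Rightarrow> 'a) \<Rightarrow> bool" where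
  "nilpotent_lie br \<longleftrightarrow> (\<exists>m. lcs br m = {0})"

definition nilindex :: "('a::euclidean_space \<Rightarrow> 'a \<Rightarrow> 'a) \<Rightarrow> nat" where
  "nilindex br = (LEAST m. lcs br m = {0})"

definition quasi_filiform :: "('a::euclidean_space \<Rightarrow> 'a \<Rightarrow> 'a) \<Rightarrow> bool" where
  "quasi_filiform br \<longleftrightarrow> nilpotent_lie br \<and> int (nilindex br) = int DIM('a) - 2"

definition complex_structure :: "('a::euclidean_space \<Rightarrow> 'a \<Rightarrow> 'a) \<Rightarrow> ('a \<Rightarrow> 'a) \<Rightarrow> bool" where
  "complex_structure br J \<longleftrightarrow> linear J \<and> (\<forall>x. J (J x) = - x) \<and>
     (\<forall>x y. br (J x) (J y) - br x y - J (br (J x) y) - J (br x (J y)) = 0)"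

definition iso_to_structure ::
  "('a::euclidean_space \<Rightarrow> 'a \<Rightarrow> 'a) \<Rightarrow> nat \<Rightarrow> (nat \<Rightarrow> nat \<Rightarrow> nat \<Rightarrow> real) \<Rightarrow> bool" where
  "iso_to_structure br n c \<longleftrightarrow> (\<exists>X :: nat \<Rightarrow> 'a.
     inj_on X {..<n} \<and> independent (X ` {..<n}) \<and> span (X ` {..<n}) = UNIV \<and>
     (\<forall>i<n. \<forall>j<n. br (X i) (X j) = (\<Sum>k<n. c i j k *\<^sub>R X k)))"

text \<open>Structure constants from a list of nonzero brackets (i,j,k) meaning [X_i,X_j] = X_k,
extended by antisymmetry; all other brackets of basis vectors vanish.\<close>

definition sc_of_list :: "(nat \<times> nat \<times> nat) list \<Rightarrow> nat \<Rightarrow> nat \<Rightarrow> nat \<Rightarrow> real" where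
  "sc_of_list l i j k = (if (i, j, k) \<in> set l then 1 else if (j, i, k) \<in> set l then -1 else 0)"

definition L3R_sc :: "nat \<Rightarrow> nat \<Rightarrow> nat \<Rightarrow> real" where
  "L3R_sc = sc_of_list [(0, 1, 2)]"

definition n63_sc :: "nat \<Rightarrow> nat \<Rightarrow> nat \<Rightarrow> real" where
  "n63_sc = sc_of_list [(0, 1, 2), (0, 2, 3), (0, 3, 4), (1, 2, 5), (1, 5, 4)]"

end

theory Submission
  imports Defs
begin

text \<open>Write \<open>g\<^sup>k\<close> for the lower central series and \<open>S k = g\<^sup>k + J g\<^sup>k\<close>. Integrability of \<open>J\<close> and the
  fact that \<open>J\<close> has no real eigenvalue show that, past the last jump of dimension at least two in
  the lower central series, the \<open>J\<close>-invariant spaces \<open>S k\<close> decrease strictly, hence by at least two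
  dimensions each time, while the \<open>g\<^sup>k\<close> only lose one. With three generators all jumps after the first
  have size one, and counting dimensions leaves dimension four. With two generators \<open>g\<^sup>1\<close> is
  \<open>J\<close>-invariant, and a \<open>(1,0)\<close>-form whose differential is divisible by the closed \<open>(1,0)\<close>-form
  forces the second jump of size two to be \<open>g\<^sup>2 / g\<^sup>3\<close>; the count then leaves dimension six, where
  \<open>J\<close>-invariance makes the quadratic form \<open>x \<mapsto> [x, [x, z]]\<close> on \<open>g / g\<^sup>1\<close> (with \<open>z\<close> spanning
  \<open>g\<^sup>1 / g\<^sup>2\<close>, and values in the line \<open>g\<^sup>3\<close>) definite, which selects the real form \<open>n\<^sub>6\<^sub>,\<^sub>3\<close>.\<close>

declare lcs.simps(2) [simp del]

text \<open>Adjoining \<open>a\<close> to \<open>A\<close> already uses up the one dimension by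
  which \<open>B\<close> may exceed it, so \<open>a\<close> spans \<open>B\<close> modulo
  \<open>A\<close>. This turns a quotient of dimension at most one into an explicit
  coefficient.\<close>

lemma codim_one_subspace:
  fixes A B :: "'a::euclidean_space set"
  assumes "subspace A" "subspace B" "A \<subseteq> B" "dim B \<le> dim A + 1" "a \<in> B" "a \<notin> A" "b \<in> B"
  obtains c where "b - c *\<^sub>R a \<in> A"
proof -
  have sp: "span A = A" using assms(1) by (simp add: span_eq_iff)
  have "dim (span (insert a A)) = dim A + 1"
    by (simp only: dim_span dim_insert sp assms(6) if_False)
  moreover have "span (insert a A) \<subseteq> B"
    using assms by (intro span_minimal) auto
  ultimately have "span (insert a A) = B"
    using assms(2,4) by (intro subspace_dim_equal) auto
  then have "\<exists>c. b - c *\<^sub>R a \<in> A"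
    using assms(7) span_breakdown_eq[of b a A] unfolding sp by blast
  then show thesis using that by blast
qed

section \<open>Lie algebras and their lower central series\<close>

locale lie_alg =
  fixes br :: "'a::euclidean_space \<Rightarrow> 'a \<Rightarrow> 'a"
  assumes lie: "lie_algebra br"
begin

lemma bil: "bilinear br" and br_self [simp]: "br x x = 0"
  and jacobi0: "br x (br y z) + br y (br z x) + br z (br x y) = 0"
  using lie by (auto simp: lie_algebra_def)

lemmas br_linear = bilinear_ladd[OF bil] bilinear_radd[OF bil] bilinear_lsub[OF bil] bilinear_rsub[OF bil]
  bilinear_lmul[OF bil] bilinear_rmul[OF bil] bilinear_lneg[OF bil] bilinear_rneg[OF bil]

lemmas br_zero [simp] = bilinear_lzero[OF bil] bilinear_rzero[OF bil]

lemma br_anti: "br x y = - br y x"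
proof -
  have "br (x + y) (x + y) = 0" by (rule br_self)
  then have "br x y + br y x = 0" unfolding br_linear by (simp add: add.commute)
  then show ?thesis by (metis eq_neg_iff_add_eq_0 add.commute)
qed

lemma jacobi: "br x (br y z) = br (br x y) z + br y (br x z)"
  using jacobi0[of x y z] br_anti[of z x] br_anti[of z "br x y"]
  by (simp add: br_linear algebra_simps)

lemma subspace_lcs: "subspace (lcs br k)"
  by (cases k) (auto simp: lcs.simps)

lemma br_left_mem_lcs: "x \<in> lcs br k \<Longrightarrow> br x y \<in> lcs br (Suc k)"
  unfolding lcs.simps by (rule span_base) auto

lemma br_right_mem_lcs: "x \<in> lcs br k \<Longrightarrow> br y x \<in> lcs br (Suc k)"
  using br_left_mem_lcs[of x k y] br_anti[of y x] subspace_neg[OF subspace_lcs] by metis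

lemma lcs_Suc_least:
  assumes "subspace W" "\<And>x y. x \<in> lcs br k \<Longrightarrow> br x y \<in> W"
  shows "lcs br (Suc k) \<subseteq> W"
  unfolding lcs.simps by (rule span_minimal) (use assms in auto)

lemma lcs_Suc_subset: "lcs br (Suc k) \<subseteq> lcs br k"
proof (induction k)
  case 0
  then show ?case by simp
next
  case (Suc k)
  show ?case
    by (rule lcs_Suc_least[OF subspace_lcs]) (meson Suc br_left_mem_lcs subsetD)
qed

lemma lcs_antimono: "i \<le> j \<Longrightarrow> lcs br j \<subseteq> lcs br i"
  by (rule lift_Suc_antimono_le[of "lcs br"]) (rule lcs_Suc_subset)

text \<open>By Jacobi, \<open>br a b\<close> acts as the commutator of the operators of
  \<open>a\<close> and \<open>b\<close>, each of which moves one step down the series.\<close>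

lemma lcs_one_bracket:
  assumes "x \<in> lcs br (Suc 0)" "y \<in> lcs br k"
  shows "br x y \<in> lcs br (Suc (Suc k))"
proof -
  have "lcs br (Suc 0) \<subseteq> {x. br x y \<in> lcs br (Suc (Suc k))}"
  proof (rule lcs_Suc_least)
    show "subspace {x. br x y \<in> lcs br (Suc (Suc k))}"
      using subspace_lcs[of "Suc (Suc k)"]
      unfolding subspace_def by (simp add: br_linear)
  next
    fix a b
    have "br (br a b) y = br a (br b y) - br b (br a y)"
      using jacobi[of a b y] by simp
    then show "br a b \<in> {x. br x y \<in> lcs br (Suc (Suc k))}"
      using assms(2) br_right_mem_lcs subspace_diff[OF subspace_lcs]
      by (metis mem_Collect_eq)
  qed
  then show ?thesis using assms(1) by auto
qed

lemma lcs_stable: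
  assumes "lcs br (Suc k) = lcs br k"
  shows "lcs br (k + i) = lcs br k"
proof (induction i)
  case (Suc i)
  then show ?case using assms by (simp add: lcs.simps)
qed simp

end

section \<open>Dimension counts along the series of a nilpotent algebra\<close>

locale nilpotent_lie_alg = lie_alg +
  fixes r :: nat
  assumes lcs_r: "lcs br r = {0}" and lcs_nz: "k < r \<Longrightarrow> lcs br k \<noteq> {0}"
begin

lemma dim_lcs_less: "k < r \<Longrightarrow> dim (lcs br (Suc k)) < dim (lcs br k)"
proof -
  assume k: "k < r"
  have "lcs br (Suc k) \<noteq> lcs br k"
    using lcs_stable[of k "r - k"] k lcs_r lcs_nz[OF k] by auto
  moreover have "dim (lcs br (Suc k)) \<ge> dim (lcs br k) \<Longrightarrow> lcs br (Suc k) = lcs br k"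
    by (intro subspace_dim_equal subspace_lcs lcs_Suc_subset)
  ultimately show ?thesis by (meson not_le)
qed

lemma dim_lcs_add: "k + i \<le> r \<Longrightarrow> dim (lcs br (k + i)) + i \<le> dim (lcs br k)"
proof (induction i)
  case (Suc i)
  then show ?case using dim_lcs_less[of "k + i"] by simp
qed simp

lemma dim_lcs_ge: "k \<le> r \<Longrightarrow> r - k \<le> dim (lcs br k)"
  using dim_lcs_add[of k "r - k"] by simp

text \<open>Each remaining step loses at least one dimension, so \<open>r - i\<close> dimensions for
  \<open>r - i\<close> steps leave no slack.\<close>

lemma dim_lcs_eq:
  assumes "i \<le> k" "k \<le> r" "dim (lcs br i) \<le> r - i"
  shows "dim (lcs br k) = r - k"
  using dim_lcs_add[of i "k - i"] dim_lcs_ge[of k] assms by simp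

end

section \<open>Subspaces invariant under an almost complex structure\<close>

locale almost_complex =
  fixes J :: "'a::euclidean_space \<Rightarrow> 'a"
  assumes J_linear: "linear J" and JJ [simp]: "J (J x) = - x"
begin

lemmas J_simps = linear_add[OF J_linear] linear_diff[OF J_linear] linear_cmul[OF J_linear]
  linear_neg[OF J_linear]

lemma J_zero [simp]: "J 0 = 0" using linear_0[OF J_linear] .

text \<open>Applying J + c to (J - c) v gives -(1 + c^2) v, a nonzero multiple of v. So
  \<open>J\<close> has no real eigenvalue on the quotient by \<open>T\<close>.\<close>

lemma J_shift_mem:
  assumes "subspace T" "\<And>x. x \<in> T \<Longrightarrow> J x \<in> T" "J v - c *\<^sub>R v \<in> T"
  shows "v \<in> T"
proof -
  have "J (J v - c *\<^sub>R v) + c *\<^sub>R (J v - c *\<^sub>R v) \<in> T"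
    using assms by (meson subspace_add subspace_scale)
  also have "J (J v - c *\<^sub>R v) + c *\<^sub>R (J v - c *\<^sub>R v) = (- (1 + c\<^sup>2)) *\<^sub>R v"
    by (simp add: J_simps algebra_simps power2_eq_square)
  finally have "(- 1 / (1 + c\<^sup>2)) *\<^sub>R ((- (1 + c\<^sup>2)) *\<^sub>R v) \<in> T"
    by (rule subspace_scale[OF assms(1)])
  moreover have "1 + c\<^sup>2 \<noteq> 0"
    by (metis add_pos_nonneg less_irrefl zero_le_power2 zero_less_one)
  then have "(- 1 / (1 + c\<^sup>2)) * (- (1 + c\<^sup>2)) = 1" by (simp add: divide_simps)
  ultimately show ?thesis by (metis scaleR_scaleR scaleR_one)
qed

lemma dim_insert_J:
  assumes "subspace T" "\<And>x. x \<in> T \<Longrightarrow> J x \<in> T" "v \<notin> T"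
  shows "dim (insert (J v) (insert v T)) = dim T + 2"
proof -
  have sp: "span T = T" using assms(1) by (simp add: span_eq_iff)
  have "J v \<notin> span (insert v T)"
    unfolding span_breakdown_eq sp using J_shift_mem assms by blast
  then show ?thesis by (simp add: dim_insert span_eq_iff[THEN iffD2, OF assms(1)] assms(3))
qed

lemma dim_J_invariant_less:
  assumes "subspace T" "\<And>x. x \<in> T \<Longrightarrow> J x \<in> T" "subspace S" "\<And>x. x \<in> S \<Longrightarrow> J x \<in> S"
    "T \<subset> S"
  shows "dim T + 2 \<le> dim S"
proof -
  obtain v where v: "v \<in> S" "v \<notin> T" using assms(5) by auto
  have "dim (insert (J v) (insert v T)) \<le> dim S"
    by (rule dim_subset) (use v assms in auto)
  then show ?thesis using dim_insert_J[OF assms(1,2) v(2)] by simp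
qed

text \<open>Take an even-dimensional invariant subspace of \<open>S\<close> of maximal dimension; if
  it were proper, adjoining some \<open>v\<close> and \<open>J v\<close> would enlarge it by
  two.\<close>

lemma even_dim_J_invariant:
  assumes "subspace S" "\<And>x. x \<in> S \<Longrightarrow> J x \<in> S"
  shows "even (dim S)"
proof -
  define P where "P T \<longleftrightarrow> subspace T \<and> J ` T \<subseteq> T \<and> T \<subseteq> S \<and> even (dim T)" for T
  have "P {0}" using assms(1) by (auto simp: P_def subspace_0)
  moreover have "\<forall>T. P T \<longrightarrow> dim T < Suc (dim S)"
    by (auto simp: P_def less_Suc_eq_le intro: dim_subset)
  ultimately obtain T where T: "P T" "\<And>T'. P T' \<Longrightarrow> dim T' \<le> dim T"
    using ex_has_greatest_nat[of P "{0}" dim] by blast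
  have "T = S"
  proof (rule ccontr)
    assume "T \<noteq> S"
    then obtain v where v: "v \<in> S" "v \<notin> T" using T(1) by (auto simp: P_def)
    define T' where "T' = span (insert (J v) (insert v T))"
    have d: "dim T' = dim T + 2"
      using dim_insert_J[of T v] v T(1) by (auto simp: P_def T'_def)
    have "J x \<in> T'" if "x \<in> T'" for x
    proof -
      have "T' \<subseteq> {x. J x \<in> T'}"
        unfolding T'_def
      proof (rule span_minimal)
        show "subspace {x. J x \<in> span (insert (J v) (insert v T))}"
          by (auto simp: subspace_def J_simps span_add span_scale span_zero)
        have "- v \<in> span (insert (J v) (insert v T))"
          by (simp add: span_base span_neg)
        then show "insert (J v) (insert v T) \<subseteq> {x. J x \<in> span (insert (J v) (insert v T))}"
          using T(1) by (auto simp: P_def intro: span_base)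
      qed
      then show ?thesis using that by auto
    qed
    moreover have "T' \<subseteq> S"
      unfolding T'_def by (rule span_minimal) (use v assms T(1) in \<open>auto simp: P_def\<close>)
    ultimately have "P T'" using d T(1) by (auto simp: P_def T'_def)
    then show False using T(2) d by force
  qed
  then show ?thesis using T(1) by (simp add: P_def)
qed

end

section \<open>Integrable \<open>J\<close> and the spaces \<open>S k\<close>\<close>

locale complex_nilpotent = nilpotent_lie_alg br r + almost_complex J
  for br :: "'a::euclidean_space \<Rightarrow> 'a \<Rightarrow> 'a" and r J +
  assumes nijenhuis: "br (J x) (J y) = br x y + J (br (J x) y) + J (br x (J y))"
begin

definition S :: "nat \<Rightarrow> 'a set"
  where "S k = {a + J b | a b. a \<in> lcs br k \<and> b \<in> lcs br k}"

lemma S_I: "a \<in> lcs br k \<Longrightarrow> b \<in> lcs br k \<Longrightarrow> a + J b \<in> S k"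
  by (auto simp: S_def)

lemma S_E:
  assumes "x \<in> S k"
  obtains a b where "a \<in> lcs br k" "b \<in> lcs br k" "x = a + J b"
  using assms by (auto simp: S_def)

lemma subspace_S: "subspace (S k)"
proof -
  have "S k = {x + y | x y. x \<in> lcs br k \<and> y \<in> J ` lcs br k}" by (auto simp: S_def)
  then show ?thesis
    using subspace_sums[OF subspace_lcs linear_subspace_image[OF J_linear subspace_lcs]]
    by simp
qed

lemma lcs_subset_S: "lcs br k \<subseteq> S k"
  using S_I[of _ k 0] subspace_0[OF subspace_lcs] by auto

lemma J_lcs_mem_S: "x \<in> lcs br k \<Longrightarrow> J x \<in> S k"
  using S_I[of 0 k x] subspace_0[OF subspace_lcs] by auto

lemma J_mem_S: "x \<in> S k \<Longrightarrow> J x \<in> S k"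
proof (erule S_E)
  fix a b assume "a \<in> lcs br k" "b \<in> lcs br k" "x = a + J b"
  then show ?thesis
    using S_I[of "- b" k a] subspace_neg[OF subspace_lcs] by (simp add: J_simps add.commute)
qed

lemma S_least:
  assumes "subspace W" "\<And>x. x \<in> W \<Longrightarrow> J x \<in> W" "lcs br k \<subseteq> W"
  shows "S k \<subseteq> W"
  using assms by (auto simp: S_def intro!: subspace_add)

lemma S_antimono: "i \<le> j \<Longrightarrow> S j \<subseteq> S i"
  using S_least[OF subspace_S J_mem_S] lcs_antimono lcs_subset_S by blast

lemma S_r: "S r = {0}"
  by (auto simp: S_def lcs_r)

text \<open>The only critical bracket is that of \<open>J b\<close> with \<open>J b'\<close>;
  \<open>nijenhuis\<close> rewrites it, up to an outer \<open>J\<close>, by brackets that have a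
  factor in g^k.\<close>

lemma S_bracket:
  assumes "x \<in> S k" "y \<in> S k"
  shows "br x y \<in> S (Suc k)"
proof -
  obtain a b a' b' where m: "a \<in> lcs br k" "b \<in> lcs br k" "a' \<in> lcs br k" "b' \<in> lcs br k"
    and e: "x = a + J b" "y = a' + J b'"
    using assms by (auto elim!: S_E)
  have "br x y = (br a y + br (J b) a' + br b b') + J (br (J b) b' + br b (J b'))"
    by (simp add: e br_linear nijenhuis J_simps)
  moreover have "br a y + br (J b) a' + br b b' \<in> lcs br (Suc k)"
    using m by (intro subspace_add[OF subspace_lcs])
      (auto intro: br_left_mem_lcs br_right_mem_lcs)
  moreover have "br (J b) b' + br b (J b') \<in> lcs br (Suc k)"
    using m by (intro subspace_add[OF subspace_lcs])
      (auto intro: br_left_mem_lcs br_right_mem_lcs)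
  ultimately show ?thesis using S_I by simp
qed

text \<open>Otherwise \<open>S_bracket\<close> would put g^1, hence also \<open>S 1\<close>, into
  every later \<open>S k\<close>, down to \<open>S r\<close>, which is zero.\<close>

lemma S_one_not_UNIV:
  assumes "0 < r"
  shows "S 1 \<noteq> UNIV"
proof
  assume U: "S 1 = UNIV"
  have "S (Suc k) = UNIV" for k
  proof (induction k)
    case 0
    then show ?case using U by simp
  next
    case (Suc k)
    have "lcs br (Suc 0) \<subseteq> S (Suc (Suc k))"
      by (rule lcs_Suc_least[OF subspace_S]) (rule S_bracket, use Suc in auto)
    then have "S 1 \<subseteq> S (Suc (Suc k))"
      unfolding One_nat_def by (intro S_least[OF subspace_S J_mem_S])
    then show ?case using U by auto
  qed
  from this[of "r - 1"] show False using S_r lcs_nz[OF assms] assms by simp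
qed

lemma dim_S_one: "0 < r \<Longrightarrow> dim (S 1) + 2 \<le> DIM('a)"
  using dim_J_invariant_less[of "S 1" UNIV] subspace_S J_mem_S S_one_not_UNIV by auto

text \<open>If a bracket survives modulo \<open>S (k + 2)\<close>, then so does its image under \<open>J\<close>, and both lie in
  the line \<open>lcs br (k + 1) / lcs br (k + 2)\<close>; but \<open>J\<close> has no real eigenvalue.\<close>

lemma S_stable_step:
  assumes eq: "S k = S (Suc k)"
    and d: "dim (lcs br (Suc k)) \<le> dim (lcs br (Suc (Suc k))) + 1"
  shows "S (Suc k) = S (Suc (Suc k))"
proof -
  have "lcs br (Suc k) \<subseteq> S (Suc (Suc k))"
  proof (rule lcs_Suc_least[OF subspace_S])
    fix e v assume e: "e \<in> lcs br k"
    then obtain s t where st: "s \<in> lcs br (Suc k)" "t \<in> lcs br (Suc k)" "e = s + J t"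
      using eq lcs_subset_S S_E by (metis subsetD)
    have Jt: "br (J t) w \<in> lcs br (Suc k)" for w
    proof -
      have "br (J t) w = br e w - br s w" by (simp add: st br_linear)
      moreover have "br s w \<in> lcs br (Suc k)"
        using br_left_mem_lcs[OF st(1)] lcs_Suc_subset by blast
      ultimately show ?thesis using br_left_mem_lcs[OF e] subspace_diff[OF subspace_lcs] by metis
    qed
    have "br (J t) v \<in> S (Suc (Suc k))"
    proof (rule ccontr)
      assume n: "br (J t) v \<notin> S (Suc (Suc k))"
      then have "br (J t) v \<notin> lcs br (Suc (Suc k))" using lcs_subset_S by blast
      then obtain c where c: "br (J t) (J v) - c *\<^sub>R br (J t) v \<in> lcs br (Suc (Suc k))"
        using codim_one_subspace[OF subspace_lcs subspace_lcs lcs_Suc_subset d Jt _ Jt] by blast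
      have "J (br (J t) v) - c *\<^sub>R br (J t) v
          = (br (J t) (J v) - c *\<^sub>R br (J t) v - br t v) + J (- br t (J v))"
        by (simp add: nijenhuis J_simps)
      also have "\<dots> \<in> S (Suc (Suc k))"
        by (intro S_I subspace_diff[OF subspace_lcs c] subspace_neg[OF subspace_lcs] br_left_mem_lcs st(2))
      finally have "br (J t) v \<in> S (Suc (Suc k))"
        using J_shift_mem[OF subspace_S J_mem_S] by blast
      then show False using n by simp
    qed
    moreover have "br s v \<in> S (Suc (Suc k))"
      using br_left_mem_lcs[OF st(1)] lcs_subset_S by blast
    ultimately show "br e v \<in> S (Suc (Suc k))"
      by (simp add: st br_linear subspace_add[OF subspace_S])
  qed
  then have "S (Suc k) \<subseteq> S (Suc (Suc k))"
    by (intro S_least[OF subspace_S J_mem_S])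
  then show ?thesis using S_antimono[of "Suc k" "Suc (Suc k)"] by auto
qed

text \<open>By \<open>S_stable_step\<close> an equality would propagate to all later indices and
  reach \<open>S r\<close>, which is zero, although g^k is not.\<close>

lemma S_strict:
  assumes "\<And>j. k \<le> j \<Longrightarrow> dim (lcs br (Suc j)) \<le> dim (lcs br (Suc (Suc j))) + 1" "k < r"
  shows "S (Suc k) \<subset> S k"
proof (rule ccontr)
  assume "\<not> S (Suc k) \<subset> S k"
  then have *: "S k = S (Suc k)" using S_antimono[of k "Suc k"] by auto
  have "S (k + i) = S k \<and> S (Suc (k + i)) = S k" for i
  proof (induction i)
    case (Suc i)
    then show ?case using S_stable_step[of "k + i"] assms(1)[of "k + i"] by simp
  qed (use * in auto)
  from this[of "r - k"] have "S k = {0}" using assms(2) S_r by simp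
  then have "lcs br k \<subseteq> {0}" using lcs_subset_S by blast
  then show False using lcs_nz[OF assms(2)] subspace_0[OF subspace_lcs[of k]] by blast
qed

text \<open>Each strict inclusion of \<open>J\<close>-invariant spaces costs at least two
  dimensions. Set against an upper bound for the dimension of \<open>S k\<close>, this bounds
  \<open>r\<close>.\<close>

lemma dim_S_ge:
  assumes "\<And>j. k \<le> j \<Longrightarrow> dim (lcs br (Suc j)) \<le> dim (lcs br (Suc (Suc j))) + 1" "k \<le> r"
  shows "2 * (r - k) \<le> dim (S k)"
  using assms
proof (induction "r - k" arbitrary: k)
  case (Suc m)
  have "2 * (r - Suc k) \<le> dim (S (Suc k))"
    by (rule Suc.hyps(1)) (use Suc in \<open>simp_all\<close>)
  moreover have "dim (S (Suc k)) + 2 \<le> dim (S k)"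
    by (rule dim_J_invariant_less[OF subspace_S J_mem_S subspace_S J_mem_S])
      (use S_strict[of k] Suc in \<open>simp_all\<close>)
  ultimately show ?case using Suc(2) by simp
qed simp

lemma even_DIM: "even DIM('a)"
  using even_dim_J_invariant[of UNIV] by simp

end

text \<open>When \<open>n\<close> vectors span an \<open>n\<close>-dimensional space they are
  distinct and independent, so only spanning and the bracket table have to be checked.\<close>

lemma iso_to_structureI:
  fixes br :: "'a::euclidean_space \<Rightarrow> 'a \<Rightarrow> 'a"
  assumes "DIM('a) = n" "span (X ` {..<n}) = UNIV"
    and "\<And>i j. i < n \<Longrightarrow> j < n \<Longrightarrow> br (X i) (X j) = (\<Sum>k<n. c i j k *\<^sub>R X k)"
  shows "iso_to_structure br n c"
proof -
  have "n \<le> card (X ` {..<n})"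
    using span_card_ge_dim[of "X ` {..<n}" UNIV] assms by simp
  then have card: "card (X ` {..<n}) = n"
    using card_image_le[of "{..<n}" X] by simp
  then have "inj_on X {..<n}" by (intro eq_card_imp_inj_on) auto
  moreover have "independent (X ` {..<n})"
    by (rule card_le_dim_spanning[of _ UNIV]) (use card assms in auto)
  ultimately show ?thesis using assms unfolding iso_to_structure_def by blast
qed

section \<open>Two generators: g^1 of codimension two\<close>

locale two_generator_complex = complex_nilpotent br r J
  for br :: "'a::euclidean_space \<Rightarrow> 'a \<Rightarrow> 'a" and r J +
  assumes r_gt_1: "1 < r" and dim_lcs_1: "dim (lcs br (Suc 0)) + 2 = DIM('a)"
begin

text \<open>A proper \<open>J\<close>-invariant subspace has codimension at least two, and g^1
  inside \<open>S 1\<close> has codimension exactly two. Thus g^1 is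
  \<open>J\<close>-invariant.\<close>

lemma S_1_eq: "S (Suc 0) = lcs br (Suc 0)"
  by (rule subspace_dim_equal[OF subspace_lcs subspace_S lcs_subset_S, symmetric])
    (use dim_S_one dim_lcs_1 r_gt_1 in auto)

lemma J_mem_lcs_1: "x \<in> lcs br (Suc 0) \<Longrightarrow> J x \<in> lcs br (Suc 0)"
  using J_mem_S[of x "Suc 0"] by (simp add: S_1_eq)

lemma generators:
  assumes "u \<notin> lcs br (Suc 0)"
  obtains a b w where "w \<in> lcs br (Suc 0)" "v = a *\<^sub>R u + b *\<^sub>R J u + w"
proof -
  let ?B = "insert (J u) (insert u (lcs br (Suc 0)))"
  have "dim ?B = DIM('a)"
    using dim_insert_J[OF subspace_lcs J_mem_lcs_1 assms] dim_lcs_1 by simp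
  then have "v \<in> span ?B" by (metis UNIV_I dim_eq_full)
  then obtain a b where "v - b *\<^sub>R J u - a *\<^sub>R u \<in> span (lcs br (Suc 0))"
    unfolding span_breakdown_eq by blast
  then have "v - b *\<^sub>R J u - a *\<^sub>R u \<in> lcs br (Suc 0)"
    by (metis span_eq_iff subspace_lcs)
  then show thesis by (rule that[of _ a b]) simp
qed

text \<open>Since \<open>u\<close> and \<open>J u\<close> span g modulo g^1, every bracket is modulo
  g^2 a multiple of \<open>br u (J u)\<close>, the factor being the determinant of the
  coordinates.\<close>

lemma lcs_1_decomp:
  assumes "u \<notin> lcs br (Suc 0)" "x \<in> lcs br (Suc 0)"
  obtains c w where "w \<in> lcs br (Suc (Suc 0))" "x = c *\<^sub>R br u (J u) + w"
proof -
  let ?z = "br u (J u)"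
  have "lcs br (Suc 0) \<subseteq> span (insert ?z (lcs br (Suc (Suc 0))))"
  proof (rule lcs_Suc_least)
    fix x y
    obtain a b w where w: "w \<in> lcs br (Suc 0)" "x = a *\<^sub>R u + b *\<^sub>R J u + w"
      using generators[OF assms(1)] .
    obtain a' b' w' where w': "w' \<in> lcs br (Suc 0)" "y = a' *\<^sub>R u + b' *\<^sub>R J u + w'"
      using generators[OF assms(1)] .
    have "br x y - (a * b' - b * a') *\<^sub>R ?z = br w y + br (a *\<^sub>R u + b *\<^sub>R J u) w'"
      unfolding w w' using br_anti[of "J u" u] by (simp add: br_linear algebra_simps)
    also have "\<dots> \<in> lcs br (Suc (Suc 0))"
      by (intro subspace_add[OF subspace_lcs] br_left_mem_lcs br_right_mem_lcs w w')
    finally show "br x y \<in> span (insert ?z (lcs br (Suc (Suc 0))))"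
      unfolding span_breakdown_eq using span_base by blast
  qed simp
  then obtain c where "x - c *\<^sub>R ?z \<in> span (lcs br (Suc (Suc 0)))"
    using assms(2) span_breakdown_eq[of x ?z "lcs br (Suc (Suc 0))"] by blast
  then have "x - c *\<^sub>R ?z \<in> lcs br (Suc (Suc 0))"
    by (metis span_eq_iff subspace_lcs)
  then show thesis by (rule that[of _ c]) simp
qed

lemma lcs_1_not_UNIV: obtains u where "u \<notin> lcs br (Suc 0)"
  using dim_lcs_1
  by (metis UNIV_eq_I dim_UNIV n_not_Suc_n add_2_eq_Suc' Suc_n_not_le_n le_SucI order_refl)

lemma dim_lcs_2: "dim (lcs br (Suc 0)) = dim (lcs br (Suc (Suc 0))) + 1"
proof -
  obtain u where u: "u \<notin> lcs br (Suc 0)" by (rule lcs_1_not_UNIV)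
  have "lcs br (Suc 0) \<subseteq> span (insert (br u (J u)) (lcs br (Suc (Suc 0))))"
  proof
    fix x assume "x \<in> lcs br (Suc 0)"
    then obtain c w where "w \<in> lcs br (Suc (Suc 0))" "x = c *\<^sub>R br u (J u) + w"
      by (rule lcs_1_decomp[OF u])
    then show "x \<in> span (insert (br u (J u)) (lcs br (Suc (Suc 0))))"
      by (auto intro!: span_add span_scale intro: span_base)
  qed
  then have "dim (lcs br (Suc 0)) \<le> dim (insert (br u (J u)) (lcs br (Suc (Suc 0))))"
    by (metis dim_span dim_subset)
  also have "\<dots> \<le> dim (lcs br (Suc (Suc 0))) + 1" by (simp add: dim_insert)
  finally show ?thesis using dim_lcs_less[OF r_gt_1] by simp
qed

text \<open>Both \<open>S 2\<close> and g^1 have even dimension, while g^2 has just one dimension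
  less than g^1; so \<open>S 2\<close> must fill g^1.\<close>

lemma S_2_eq: "S (Suc (Suc 0)) = lcs br (Suc 0)"
proof (rule subspace_dim_equal[OF subspace_S subspace_lcs])
  show "S (Suc (Suc 0)) \<subseteq> lcs br (Suc 0)"
    using S_antimono[of "Suc 0" "Suc (Suc 0)"] S_1_eq by simp
  have "dim (lcs br (Suc (Suc 0))) \<le> dim (S (Suc (Suc 0)))"
    by (intro dim_subset lcs_subset_S)
  moreover have "even (dim (S (Suc (Suc 0))))" "even (dim (lcs br (Suc 0)))"
    using even_dim_J_invariant subspace_S J_mem_S subspace_lcs J_mem_lcs_1 by blast+
  ultimately show "dim (lcs br (Suc 0)) \<le> dim (S (Suc (Suc 0)))"
    using dim_lcs_2 by (metis Suc_eq_plus1 even_Suc le_antisym not_less_eq_eq)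
qed

section \<open>The jump from g^2 to g^3\<close>

definition K :: "'a set"
  where "K = span {br x y | x y. x \<in> lcs br (Suc 0) \<and> y \<in> lcs br (Suc 0)}"

text \<open>The third family measures how far the operators \<open>br x\<close> with
  \<open>x\<close> in g^1 are from being complex linear. Modulo \<open>D\<close> they commute with
  \<open>J\<close> and vanish on g^1.\<close>

definition D :: "'a set"
  where "D = span (K \<union> J ` K \<union> {br x (J y) - J (br x y) | x y. x \<in> lcs br (Suc 0)})"

lemma subspace_K: "subspace K" and subspace_D: "subspace D"
  by (simp_all add: K_def D_def)

lemma K_base: "x \<in> lcs br (Suc 0) \<Longrightarrow> y \<in> lcs br (Suc 0) \<Longrightarrow> br x y \<in> K"
  unfolding K_def by (rule span_base) auto

lemma K_subset_D: "K \<subseteq> D"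
  by (auto simp: D_def intro: span_base)

lemma K_ideal: "x \<in> K \<Longrightarrow> br y x \<in> K"
proof -
  have "K \<subseteq> {x. br y x \<in> K}"
    unfolding K_def
  proof (rule span_minimal, fold K_def)
    show "subspace {x. br y x \<in> K}"
      using subspace_K unfolding subspace_def by (simp add: br_linear)
    show "{br x y | x y. x \<in> lcs br (Suc 0) \<and> y \<in> lcs br (Suc 0)} \<subseteq> {x. br y x \<in> K}"
    proof clarify
      fix a b assume ab: "a \<in> lcs br (Suc 0)" "b \<in> lcs br (Suc 0)"
      have m: "br y c \<in> lcs br (Suc 0)" for c
        using br_left_mem_lcs[of y 0] by simp
      show "br y (br a b) \<in> K"
        unfolding jacobi[of y a b] using ab m by (intro subspace_add[OF subspace_K] K_base)
    qed
  qed
  then show "x \<in> K \<Longrightarrow> br y x \<in> K" by auto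
qed

lemma J_mem_D: "x \<in> D \<Longrightarrow> J x \<in> D"
proof -
  have "D \<subseteq> {x. J x \<in> D}"
    unfolding D_def
  proof (rule span_minimal, fold D_def)
    show "subspace {x. J x \<in> D}"
      using subspace_D unfolding subspace_def by (simp add: J_simps)
    have "J (br x (J y) - J (br x y)) \<in> D" if "x \<in> lcs br (Suc 0)" for x y
    proof -
      have "J (br x (J y) - J (br x y)) = - (br x (J (J y)) - J (br x (J y)))"
        by (simp add: J_simps br_linear)
      also have "\<dots> \<in> D"
        unfolding D_def by (intro span_neg span_base) (use that in blast)
      finally show ?thesis .
    qed
    moreover have "- x \<in> D" if "x \<in> K" for x
      using that K_subset_D subspace_neg[OF subspace_D] by blast
    moreover have "J x \<in> D" if "x \<in> K" for x
      unfolding D_def using that by (auto intro: span_base)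
    ultimately show "K \<union> J ` K \<union> {br x (J y) - J (br x y) | x y. x \<in> lcs br (Suc 0)} \<subseteq> {x. J x \<in> D}"
      by auto
  qed
  then show "x \<in> D \<Longrightarrow> J x \<in> D" by auto
qed

text \<open>The complex linear forms on \<open>lcs br 1\<close> that vanish on \<open>D\<close> are the restrictions of the
  \<open>(1,0)\<close>-forms \<open>\<theta>\<close> with \<open>d\<theta>\<close> divisible by the closed \<open>(1,0)\<close>-form; this lemma provides one.\<close>

lemma lcs_1_not_subset_D: "\<not> lcs br (Suc 0) \<subseteq> D"
proof
  assume sub: "lcs br (Suc 0) \<subseteq> D"
  \<comment> \<open>If g^1 lies in \<open>S (Suc k)\<close>, each \<open>x\<close> in g^1 is
    \<open>s + J t\<close> with \<open>s\<close> and \<open>t\<close> in g^(k+1). Integrability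
    writes the defect of complex linearity through brackets with \<open>s\<close> and
    \<open>t\<close>, so \<open>D\<close>, and with it g^1, lies in the next
    \<open>S\<close>.\<close>
  have "lcs br (Suc 0) \<subseteq> S (Suc k)" for k
  proof (induction k)
    case 0
    show ?case by (rule lcs_subset_S)
  next
    case (Suc k)
    have "K \<subseteq> S (Suc (Suc k))"
      unfolding K_def by (rule span_minimal[OF _ subspace_S]) (use Suc S_bracket in blast)
    moreover have "br x (J y) - J (br x y) \<in> S (Suc (Suc k))" if x: "x \<in> lcs br (Suc 0)" for x y
    proof -
      obtain s t where st: "s \<in> lcs br (Suc k)" "t \<in> lcs br (Suc k)" "x = s + J t"
        using Suc x S_E by (metis subsetD)
      have "br x (J y) - J (br x y) = (br s (J y) + br t y) + J (br t (J y) - br s y)"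
        by (simp add: st br_linear J_simps nijenhuis)
      also have "\<dots> \<in> S (Suc (Suc k))"
        by (intro S_I subspace_add[OF subspace_lcs] subspace_diff[OF subspace_lcs] br_left_mem_lcs st)
      finally show ?thesis .
    qed
    ultimately have "D \<subseteq> S (Suc (Suc k))"
      unfolding D_def by (intro span_minimal[OF _ subspace_S]) (auto intro: J_mem_S)
    then show ?case using sub by blast
  qed
  from this[of "r - 1"] have "lcs br (Suc 0) \<subseteq> {0}" using r_gt_1 S_r by simp
  then show False using lcs_nz[of "Suc 0"] r_gt_1 subspace_0[OF subspace_lcs] by fastforce
qed

text \<open>If g^2 / g^3 is at most a line, then \<open>u\<close> or some J u - c u brackets
  \<open>br u (J u)\<close> into g^3. The latter avoids g^1 because \<open>J\<close> has no real
  eigenvalue on g / g^1.\<close>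

lemma shifted_generator:
  assumes "dim (lcs br (Suc (Suc 0))) \<le> dim (lcs br (Suc (Suc (Suc 0)))) + 1"
  obtains y where "y \<notin> lcs br (Suc 0)"
    "\<And>x. x \<in> lcs br (Suc 0) \<Longrightarrow> br y x \<in> lcs br (Suc (Suc (Suc 0)))"
proof -
  obtain u where u: "u \<notin> lcs br (Suc 0)" by (rule lcs_1_not_UNIV)
  let ?z = "br u (J u)"
  have z: "br v ?z \<in> lcs br (Suc (Suc 0))" for v
    using br_left_mem_lcs[of u 0] by (intro br_right_mem_lcs) simp
  have "\<exists>y. y \<notin> lcs br (Suc 0) \<and> br y ?z \<in> lcs br (Suc (Suc (Suc 0)))"
  proof (cases "br u ?z \<in> lcs br (Suc (Suc (Suc 0)))")
    case False
    then obtain c where "br (J u) ?z - c *\<^sub>R br u ?z \<in> lcs br (Suc (Suc (Suc 0)))"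
      using codim_one_subspace[OF subspace_lcs subspace_lcs lcs_Suc_subset assms z _ z] by blast
    moreover have "J u - c *\<^sub>R u \<notin> lcs br (Suc 0)"
      using J_shift_mem[OF subspace_lcs J_mem_lcs_1] u by blast
    ultimately show ?thesis by (intro exI[of _ "J u - c *\<^sub>R u"]) (simp add: br_linear)
  qed (use u in blast)
  then obtain y where y: "y \<notin> lcs br (Suc 0)" "br y ?z \<in> lcs br (Suc (Suc (Suc 0)))" by blast
  show thesis
  proof (rule that[OF y(1)])
    fix x assume "x \<in> lcs br (Suc 0)"
    then obtain c w where "w \<in> lcs br (Suc (Suc 0))" "x = c *\<^sub>R ?z + w"
      by (rule lcs_1_decomp[OF u])
    then show "br y x \<in> lcs br (Suc (Suc (Suc 0)))"
      using y(2) by (auto simp: br_linear intro!: subspace_add[OF subspace_lcs]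
          subspace_scale[OF subspace_lcs] br_right_mem_lcs)
  qed
qed

text \<open>With a smaller jump, the generator \<open>y\<close> of \<open>shifted_generator\<close>
  would force all of g^1 into \<open>D\<close>, against \<open>lcs_1_not_subset_D\<close>.\<close>

lemma dim_lcs_3:
  "dim (lcs br (Suc (Suc (Suc 0)))) + 2 \<le> dim (lcs br (Suc (Suc 0)))"
proof (rule ccontr)
  assume "\<not> ?thesis"
  then obtain y where y: "y \<notin> lcs br (Suc 0)"
    and y3: "\<And>x. x \<in> lcs br (Suc 0) \<Longrightarrow> br y x \<in> lcs br (Suc (Suc (Suc 0)))"
    using shifted_generator by (metis Suc_eq_plus1 add_2_eq_Suc' not_less_eq_eq)
  define W where "W k = {a + b | a b. a \<in> lcs br k \<and> b \<in> K}" for k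
  have sW: "subspace (W k)" for k
    unfolding W_def by (rule subspace_sums[OF subspace_lcs subspace_K])
  have WI: "a \<in> lcs br k \<Longrightarrow> b \<in> K \<Longrightarrow> a + b \<in> W k" for a b k
    by (auto simp: W_def)
  txt \<open>Modulo \<open>K\<close> the operators \<open>br y\<close> and \<open>br w\<close> commute on \<open>lcs br 1\<close>, so \<open>br y\<close> raises
    the filtration by two everywhere because it does so on \<open>lcs br 1\<close>.\<close>
  have yW: "br y x \<in> W (Suc (Suc (Suc j)))" if "x \<in> lcs br (Suc j)" for x j
    using that
  proof (induction j arbitrary: x)
    case 0
    then show ?case using y3 WI[of _ _ 0] subspace_0[OF subspace_K] by fastforce
  next
    case (Suc j)
    have "lcs br (Suc (Suc j)) \<subseteq> {x. br y x \<in> W (Suc (Suc (Suc (Suc j))))}"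
    proof (rule lcs_Suc_least)
      show "subspace {x. br y x \<in> W (Suc (Suc (Suc (Suc j))))}"
        using sW[of "Suc (Suc (Suc (Suc j)))"] unfolding subspace_def by (simp add: br_linear)
    next
      fix u w assume u: "u \<in> lcs br (Suc j)"
      obtain a b where ab: "a \<in> lcs br (Suc (Suc (Suc j)))" "b \<in> K" "br y u = a + b"
        using Suc.IH[OF u] by (auto simp: W_def)
      have "br y (br u w) = br a w + (- br w b + br u (br y w))"
        using jacobi[of y u w] br_anti[of b w] by (simp add: ab br_linear)
      moreover have "- br w b + br u (br y w) \<in> K"
      proof (intro subspace_add[OF subspace_K] subspace_neg[OF subspace_K])
        show "br w b \<in> K" using ab(2) by (rule K_ideal)
        show "br u (br y w) \<in> K"
          using u lcs_antimono[of "Suc 0" "Suc j"] br_left_mem_lcs[of y 0]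
          by (intro K_base) auto
      qed
      ultimately show "br u w \<in> {x. br y x \<in> W (Suc (Suc (Suc (Suc j))))}"
        using WI br_left_mem_lcs[OF ab(1)] by simp
    qed
    then show ?case using Suc.prems by auto
  qed
  define E where "E k = {a + b | a b. a \<in> D \<and> b \<in> S k}" for k
  have sE: "subspace (E k)" for k
    unfolding E_def by (rule subspace_sums[OF subspace_D subspace_S])
  have JE: "J x \<in> E k" if "x \<in> E k" for x k
    using that J_mem_D J_mem_S unfolding E_def by (force simp: J_simps)
  have DE: "D \<subseteq> E k" for k
    unfolding E_def using subspace_0[OF subspace_S] by force
  have SE: "S k \<subseteq> E k" for k
    unfolding E_def using subspace_0[OF subspace_D] by force
  have WE: "W k \<subseteq> E k" for k
    unfolding W_def using subspace_add[OF sE] DE SE lcs_subset_S K_subset_D by blast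
  \<comment> \<open>Modulo \<open>D\<close>, \<open>br e v\<close> is controlled by
    \<open>br e y\<close>: complex linearity handles the part of \<open>v\<close> along
    \<open>J y\<close>, and \<open>K\<close> the part in g^1. By \<open>yW\<close>,
    \<open>br e y\<close> lies one step deeper than expected.\<close>
  have step: "S (Suc (Suc j)) \<subseteq> E (Suc (Suc (Suc j)))" for j
  proof (rule S_least[OF sE JE], assumption, rule lcs_Suc_least[OF sE])
    fix e v assume e: "e \<in> lcs br (Suc j)"
    then have e1: "e \<in> lcs br (Suc 0)" using lcs_antimono[of "Suc 0" "Suc j"] by auto
    obtain a b w where w: "w \<in> lcs br (Suc 0)" "v = a *\<^sub>R y + b *\<^sub>R J y + w"
      using generators[OF y] .
    have ey: "br e y \<in> E (Suc (Suc (Suc j)))"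
      using yW[OF e] WE br_anti[of e y] subspace_neg[OF sE] by (metis subsetD)
    have "br e (J y) - J (br e y) \<in> D"
      unfolding D_def by (rule span_base) (use e1 in blast)
    then have "(br e (J y) - J (br e y)) + J (br e y) \<in> E (Suc (Suc (Suc j)))"
      using DE JE[OF ey] by (intro subspace_add[OF sE]) auto
    then have eJy: "br e (J y) \<in> E (Suc (Suc (Suc j)))" by simp
    have ew: "br e w \<in> E (Suc (Suc (Suc j)))"
      using K_base[OF e1 w(1)] K_subset_D DE by blast
    show "br e v \<in> E (Suc (Suc (Suc j)))"
      unfolding w br_linear by (intro subspace_add[OF sE] subspace_scale[OF sE] ey eJy ew)
  qed
  \<comment> \<open>Starting from g^1 = \<open>S 2\<close>, the space g^1 sinks through
    \<open>E 2\<close>, \<open>E 3\<close> and so on to \<open>E r\<close>, which is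
    \<open>D\<close>.\<close>
  have "lcs br (Suc 0) \<subseteq> E (Suc (Suc j))" for j
  proof (induction j)
    case 0
    then show ?case using SE[of "Suc (Suc 0)"] by (simp add: S_2_eq)
  next
    case (Suc j)
    have "E (Suc (Suc j)) \<subseteq> E (Suc (Suc (Suc j)))"
      using step[of j] DE subspace_add[OF sE] unfolding E_def[of "Suc (Suc j)"] by blast
    then show ?case using Suc by blast
  qed
  from this[of "r - 2"] have "lcs br (Suc 0) \<subseteq> E r"
    using r_gt_1 by (simp add: numeral_2_eq_2 Suc_diff_Suc)
  moreover have "E r = D" by (auto simp: E_def S_r)
  ultimately show False using lcs_1_not_subset_D by simp
qed

end

section \<open>Dimension six, with series of dimensions 6, 4, 3, 1, 0\<close>

locale six_dim_complex = two_generator_complex br r J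
  for br :: "'a::euclidean_space \<Rightarrow> 'a \<Rightarrow> 'a" and r J +
  assumes r_eq: "r = 4" and DIM_eq: "DIM('a) = 6"
    and dim_2: "dim (lcs br 2) = 3" and dim_3: "dim (lcs br 3) = 1"
begin

lemma lcs_4: "lcs br 4 = {0}"
  using lcs_r r_eq by simp

lemma br_lcs_0: "br x y \<in> lcs br 1"
  using br_left_mem_lcs[of x 0] by simp

lemma br_lcs_1: "x \<in> lcs br 1 \<Longrightarrow> br y x \<in> lcs br 2"
  using br_right_mem_lcs[of x 1] by (simp add: numeral_2_eq_2)

lemma br_lcs_2: "x \<in> lcs br 2 \<Longrightarrow> br y x \<in> lcs br 3"
  using br_right_mem_lcs[of x 2] by (simp add: numeral_3_eq_3)

lemma br_lcs_3: "x \<in> lcs br 3 \<Longrightarrow> br y x = 0"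
  using br_right_mem_lcs[of x 3] lcs_4 by (simp add: numeral_eq_Suc)

lemma br_lcs_1_2: "x \<in> lcs br 1 \<Longrightarrow> y \<in> lcs br 2 \<Longrightarrow> br x y = 0"
  using lcs_one_bracket[of x y 2] lcs_4 by (simp add: numeral_eq_Suc)

lemma lcs_1_decomp':
  assumes "u \<notin> lcs br 1" "x \<in> lcs br 1"
  obtains c w where "w \<in> lcs br 2" "x = c *\<^sub>R br u (J u) + w"
  using lcs_1_decomp[of u x] assms unfolding One_nat_def numeral_2_eq_2 by blast

text \<open>Modulo g^2 the space g^1 is spanned by one vector, and brackets of g^1 with g^2 fall
  into g^4, which is zero.\<close>

lemma br_lcs_1_1:
  assumes "x \<in> lcs br 1" "y \<in> lcs br 1"
  shows "br x y = 0"
proof -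
  obtain u where u: "u \<notin> lcs br 1" using lcs_1_not_UNIV by auto
  obtain a v where v: "v \<in> lcs br 2" "x = a *\<^sub>R br u (J u) + v"
    using lcs_1_decomp'[OF u assms(1)] .
  obtain b w where w: "w \<in> lcs br 2" "y = b *\<^sub>R br u (J u) + w"
    using lcs_1_decomp'[OF u assms(2)] .
  show ?thesis
    using br_lcs_1_2[OF br_lcs_0 w(1), of u "J u"] br_lcs_1_2[OF assms(2) v(1)]
      br_anti[of v y] br_lcs_1_2[OF br_lcs_0 v(1), of u "J u"]
    unfolding v(2) by (simp add: br_linear w(2))
qed

text \<open>The commutator of the two operators is the bracket with \<open>br v w\<close>, an
  element of the abelian g^1.\<close>

lemma br_commute_on_lcs_1:
  assumes "x \<in> lcs br 1"
  shows "br v (br w x) = br w (br v x)"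
  using jacobi[of v w x] br_lcs_1_1[OF br_lcs_0 assms, of v w] by simp

lemma lcs_3_J_disjoint:
  assumes "x \<in> lcs br 3" "J x \<in> lcs br 3"
  shows "x = 0"
proof (rule ccontr)
  assume "x \<noteq> 0"
  then have "dim (insert (J x) (insert x {0})) = 2"
    using dim_insert_J[of "{0}" x] by simp
  moreover have "dim (insert (J x) (insert x {0})) \<le> dim (lcs br 3)"
    using assms subspace_0[OF subspace_lcs] by (intro dim_subset) auto
  ultimately show False using dim_3 by simp
qed

text \<open>As g^1 is abelian and a line modulo g^2, two brackets generate g^2 over g^3. With
  \<open>W\<close> a preimage under some \<open>br v\<close>, claims about g^2 reduce to two
  vectors.\<close>

lemma lcs_2_least:
  assumes "subspace W" "u \<notin> lcs br 1" "br u (br u (J u)) \<in> W"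
    "br (J u) (br u (J u)) \<in> W" "lcs br 3 \<subseteq> W"
  shows "lcs br 2 \<subseteq> W"
proof -
  have "lcs br (Suc 1) \<subseteq> W"
  proof (rule lcs_Suc_least[OF assms(1)])
    fix x y assume x: "x \<in> lcs br 1"
    let ?z = "br u (J u)"
    obtain c w where w: "w \<in> lcs br 2" "x = c *\<^sub>R ?z + w" using lcs_1_decomp'[OF assms(2) x] .
    obtain a b v where v: "v \<in> lcs br 1" "y = a *\<^sub>R u + b *\<^sub>R J u + v"
      using generators[of u y] assms(2) unfolding One_nat_def by blast
    have "br x y = - (c *\<^sub>R (a *\<^sub>R br u ?z + b *\<^sub>R br (J u) ?z)) - br y w"
    proof -
      have "br y ?z = a *\<^sub>R br u ?z + b *\<^sub>R br (J u) ?z"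
        using br_lcs_1_1[OF v(1) br_lcs_0] by (simp add: v(2) br_linear)
      then show ?thesis using br_anti[of x y] unfolding w(2) br_linear by simp
    qed
    also have "\<dots> \<in> W"
      using br_lcs_2[OF w(1)] assms by (intro subspace_diff subspace_neg subspace_scale subspace_add) auto
    finally show "br x y \<in> W" .
  qed
  then show ?thesis by (simp add: numeral_2_eq_2)
qed

lemma lcs_3_nz: obtains w where "w \<in> lcs br 3" "w \<noteq> 0"
  using lcs_nz[of 3] r_eq subspace_0[OF subspace_lcs] by auto

lemma lcs_3_least:
  assumes "subspace W" "u \<notin> lcs br 1"
    "\<And>v. v \<in> {u, J u} \<Longrightarrow> br v (br u (br u (J u))) \<in> W"
    "\<And>v. v \<in> {u, J u} \<Longrightarrow> br v (br (J u) (br u (J u))) \<in> W"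
  shows "lcs br 3 \<subseteq> W"
proof -
  have *: "lcs br 2 \<subseteq> {x. br v x \<in> W}" if "v \<in> {u, J u}" for v
  proof (rule lcs_2_least[OF _ assms(2)])
    show "subspace {x. br v x \<in> W}"
      using assms(1) unfolding subspace_def by (simp add: br_linear)
  qed (use assms that br_lcs_3 subspace_0 in auto)
  have "lcs br (Suc 2) \<subseteq> W"
  proof (rule lcs_Suc_least[OF assms(1)])
    fix x y assume x: "x \<in> lcs br 2"
    obtain a b v where v: "v \<in> lcs br 1" "y = a *\<^sub>R u + b *\<^sub>R J u + v"
      using generators[of u y] assms(2) unfolding One_nat_def by blast
    have "br x y = - (a *\<^sub>R br u x + b *\<^sub>R br (J u) x)"
      using br_anti[of x y] br_lcs_1_2[OF v(1) x] by (simp add: v(2) br_linear)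
    also have "\<dots> \<in> W"
      using *[of u] *[of "J u"] x assms(1) by (intro subspace_neg subspace_scale subspace_add) auto
    finally show "br x y \<in> W" .
  qed
  then show ?thesis by (simp add: numeral_3_eq_3 numeral_2_eq_2)
qed

text \<open>Since \<open>w\<close> is central, two terms of \<open>nijenhuis\<close> drop out. Thus
  \<open>v \<mapsto> br v (J w)\<close> is complex linear.\<close>

lemma br_J_lcs_3:
  assumes w: "w \<in> lcs br 3"
  shows "br (J v) (J w) = J (br v (J w))"
  using nijenhuis[of v w] br_lcs_3[OF w] by simp

text \<open>Under the contrary inclusion the plane \<open>S 3\<close> is central. Some
  \<open>v\<close> with \<open>br v ?z\<close> equal to \<open>J w\<close> modulo g^3 then
  annihilates g^2, and integrability for \<open>v\<close> and \<open>br (J v) (br v (J v))\<close>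
  forces the latter into \<open>S 3\<close>, which would make g^3 zero.\<close>

lemma J_lcs_3_not_subset: "\<not> J ` lcs br 3 \<subseteq> lcs br 2"
proof
  assume sub: "J ` lcs br 3 \<subseteq> lcs br 2"
  have cJ: "br v (J w) = 0" if w: "w \<in> lcs br 3" for v w
  proof -
    have "J w \<in> lcs br 2" using sub w by auto
    then show ?thesis
      using lcs_3_J_disjoint[of "br v (J w)"] br_lcs_2 br_J_lcs_3[OF w, of v] by metis
  qed
  have cS: "br v x = 0" if "x \<in> S 3" for v x
    using that by (auto elim!: S_E simp: br_linear cJ br_lcs_3)
  obtain w where w: "w \<in> lcs br 3" "w \<noteq> 0" by (rule lcs_3_nz)
  \<comment> \<open>Otherwise \<open>e\<close>, \<open>J e\<close> and \<open>S 3\<close> would span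
    at least four dimensions inside g^2, which has three.\<close>
  have S3: "e \<in> S 3" if e: "e \<in> lcs br 2" "J e \<in> lcs br 2" for e
  proof (rule ccontr)
    assume n: "e \<notin> S 3"
    have "w \<in> S 3" using w lcs_subset_S by blast
    then have "dim {0::'a} + 2 \<le> dim (S 3)"
      using w subspace_0[OF subspace_S, of 3]
      by (intro dim_J_invariant_less[OF _ _ subspace_S J_mem_S]) auto
    moreover have "dim (insert (J e) (insert e (S 3))) = dim (S 3) + 2"
      by (rule dim_insert_J[OF subspace_S J_mem_S n])
    moreover have "S 3 \<subseteq> lcs br 2"
      using sub lcs_Suc_subset[of 2] subspace_add[OF subspace_lcs[of 2]]
      by (auto elim!: S_E simp: numeral_3_eq_3 numeral_2_eq_2)
    then have "dim (insert (J e) (insert e (S 3))) \<le> dim (lcs br 2)"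
      using e by (intro dim_subset) auto
    ultimately show False using dim_2 by simp
  qed
  obtain u where u: "u \<notin> lcs br 1" using lcs_1_not_UNIV by auto
  let ?z = "br u (J u)"
  have "\<exists>v l. l \<in> lcs br 3 \<and> J w = br v ?z + l"
  proof -
    define W where "W = {a + b | a b. a \<in> range (\<lambda>v. br v ?z) \<and> b \<in> lcs br 3}"
    have lin: "linear (\<lambda>v. br v ?z)" by (rule linearI) (simp_all add: br_linear)
    have "subspace W"
      unfolding W_def using linear_subspace_image[OF lin subspace_UNIV] by (intro subspace_sums subspace_lcs)
    then have "lcs br 2 \<subseteq> W"
    proof (rule lcs_2_least[OF _ u])
      have WI: "br v ?z + l \<in> W" if "l \<in> lcs br 3" for v l using that by (auto simp: W_def)
      show "br u ?z \<in> W" "br (J u) ?z \<in> W"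
        using WI[of 0] subspace_0[OF subspace_lcs] by auto
      show "lcs br 3 \<subseteq> W" using WI[of _ 0] by auto
    qed
    then have "J w \<in> W" using sub w(1) by blast
    then show ?thesis unfolding W_def by blast
  qed
  then obtain v l where l: "l \<in> lcs br 3" and Jw: "J w = br v ?z + l" by blast
  have v: "v \<notin> lcs br 1"
  proof
    assume "v \<in> lcs br 1"
    then have "br v ?z = 0" using br_lcs_1_1 br_lcs_0 by blast
    then show False using Jw l lcs_3_J_disjoint[OF w(1)] w(2) by simp
  qed
  obtain c m where m: "m \<in> lcs br 2" and c: "?z = c *\<^sub>R br v (J v) + m"
    using lcs_1_decomp'[OF v br_lcs_0] .
  let ?y = "br v (J v)"
  have vz: "br s (br v ?z) = 0" for s
  proof -
    have "br v ?z = J w - l" by (simp add: Jw)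
    then show ?thesis using cJ[OF w(1)] br_lcs_3[OF l] by (simp add: br_linear)
  qed
  have c0: "c \<noteq> 0"
  proof
    assume "c = 0"
    then have "br v ?z \<in> lcs br 3" using c m br_lcs_2 by simp
    then have "J w \<in> lcs br 3" using Jw l subspace_add[OF subspace_lcs] by simp
    then show False using lcs_3_J_disjoint[OF w(1)] w(2) by simp
  qed
  have vy: "br s (br v ?y) = 0" for s
    using vz[of s] br_lcs_3[OF br_lcs_2[OF m]] c0 unfolding c br_linear by simp
  have v2: "br v x = 0" if "x \<in> lcs br 2" for x
  proof -
    have "lcs br 2 \<subseteq> {x. br v x \<in> {0}}"
    proof (rule lcs_2_least[OF _ v])
      show "subspace {x. br v x \<in> {0}}" by (auto simp: subspace_def br_linear)
      show "br (J v) ?y \<in> {x. br v x \<in> {0}}"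
        using vy br_commute_on_lcs_1[OF br_lcs_0, of v "J v"] by simp
    qed (use vy br_lcs_3 in auto)
    then show ?thesis using that by auto
  qed
  let ?e = "br (J v) ?y"
  have e2: "?e \<in> lcs br 2" by (intro br_lcs_1 br_lcs_0)
  \<comment> \<open>If \<open>?e\<close> were central, all four double brackets that generate g^3
    would vanish.\<close>
  have e: "?e \<notin> S 3"
  proof
    assume "?e \<in> S 3"
    then have "lcs br 3 \<subseteq> {0}"
      using vy cS by (intro lcs_3_least[OF _ v]) auto
    then show False using w by auto
  qed
  have "J ?e \<in> lcs br 1"
    using J_mem_lcs_1[of ?e] br_lcs_0 by simp
  then obtain a n where n: "n \<in> lcs br 2" and a: "J ?e = a *\<^sub>R ?y + n"
    using lcs_1_decomp'[OF v] by blast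
  have "a \<noteq> 0" using S3[OF e2] e n a by auto
  have "br v ?y \<in> S 3"
  proof -
    have "c *\<^sub>R br v ?y = (J w - l) - br v m"
      using Jw c by (simp add: br_linear algebra_simps)
    also have "\<dots> \<in> S 3"
      using J_lcs_mem_S[OF w(1)] lcs_subset_S[of 3] l br_lcs_2[OF m]
      by (intro subspace_diff[OF subspace_S]) auto
    finally show ?thesis using c0 by (metis subspace_S subspace_scale scaleR_scaleR left_inverse scaleR_one)
  qed
  then have vJe: "br v (J ?e) \<in> S 3"
    using v2[OF n] by (simp add: a br_linear subspace_scale[OF subspace_S])
  have "br (J v) (J ?e) = J (br (J v) ?e) + J (br v (J ?e))"
    using nijenhuis[of v ?e] v2[OF e2] by simp
  also have "\<dots> \<in> S 3"
    using vJe J_mem_S J_lcs_mem_S br_lcs_2[OF e2] by (intro subspace_add[OF subspace_S]) auto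
  finally have "br (J v) (J ?e) - br (J v) n \<in> S 3"
    using br_lcs_2[OF n] lcs_subset_S by (intro subspace_diff[OF subspace_S]) auto
  then have "a *\<^sub>R ?e \<in> S 3" by (simp add: a br_linear)
  then have "?e \<in> S 3"
    using \<open>a \<noteq> 0\<close> by (metis subspace_S subspace_scale scaleR_scaleR left_inverse scaleR_one)
  then show False using e by simp
qed

lemma iso_n63: "iso_to_structure br 6 n63_sc"
proof -
  obtain w where w: "w \<in> lcs br 3" "J w \<notin> lcs br 2" using J_lcs_3_not_subset by auto
  obtain u where u: "u \<notin> lcs br 1" using lcs_1_not_UNIV by auto
  define z where "z = br u (J u)"
  have z1: "z \<in> lcs br 1" unfolding z_def by (rule br_lcs_0)
  have Jw1: "J w \<in> lcs br 1"
    using J_mem_lcs_1[of w] w(1) lcs_antimono[of 1 3] by auto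
  have "lcs br 2 \<subseteq> lcs br 1" by (rule lcs_antimono) simp
  moreover have "dim (lcs br 1) \<le> dim (lcs br 2) + 1" using dim_lcs_1 DIM_eq dim_2 by simp
  ultimately obtain c where c: "z - c *\<^sub>R J w \<in> lcs br 2"
    using codim_one_subspace[OF subspace_lcs subspace_lcs _ _ Jw1 w(2) z1] by blast
  \<comment> \<open>Double brackets kill g^2, so \<open>z\<close> may be replaced by a multiple of
    \<open>J w\<close>, where \<open>br_J_lcs_3\<close> applies.\<close>
  have zz: "br s (br t z) = c *\<^sub>R br s (br t (J w))" for s t
  proof -
    have "br s (br t (z - c *\<^sub>R J w)) = 0" using br_lcs_3 br_lcs_2 c by blast
    then show ?thesis by (simp add: br_linear)
  qed
  define p where "p = br u (J w)"
  have p2: "p \<in> lcs br 2" unfolding p_def by (rule br_lcs_1[OF Jw1])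
  have q: "br (J u) (J w) = J p" unfolding p_def by (rule br_J_lcs_3[OF w(1)])
  then have q2: "J p \<in> lcs br 2" using br_lcs_1[OF Jw1] by metis
  have nij: "br (J u) (J p) - br u p = J (br (J u) p + br u (J p))"
    using nijenhuis[of u p] by (simp add: J_simps)
  \<comment> \<open>The left side of \<open>nij\<close> and the argument of \<open>J\<close> on its
    right both lie in g^3, a line that meets its image under \<open>J\<close> only in zero.\<close>
  have "br (J u) p + br u (J p) = 0"
    using nij p2 q2 br_lcs_2 subspace_diff[OF subspace_lcs] subspace_add[OF subspace_lcs]
    by (metis lcs_3_J_disjoint)
  moreover have "br u (J p) = br (J u) p"
    using br_commute_on_lcs_1[OF Jw1, of u "J u"] by (simp add: q p_def)
  ultimately have off: "br u (J p) = 0" "br (J u) p = 0"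
    by (simp_all flip: scaleR_2)
  \<comment> \<open>Equal diagonal and zero mixed values: the form is definite, which gives
    [X_1, X_5] = X_4 its positive sign.\<close>
  have diag: "br (J u) (J p) = br u p" using nij off by simp
  define X where "X = (!) [u, J u, z, br u z, br u (br u z), br (J u) z]"
  have X: "X 0 = u" "X (Suc 0) = J u" "X 2 = z" "X 3 = br u z" "X 4 = br u (br u z)" "X 5 = br (J u) z"
    by (simp_all add: X_def numeral_eq_Suc)
  have b03: "br u (br (J u) z) = 0" "br (J u) (br u z) = 0" "br (J u) (br (J u) z) = br u (br u z)"
    by (simp_all add: zz q off diag flip: p_def)
  have m2: "br u z \<in> lcs br 2" "br (J u) z \<in> lcs br 2" by (intro br_lcs_1[OF z1])+
  have m3: "br u (br u z) \<in> lcs br 3" by (rule br_lcs_2[OF m2(1)])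
  have im: "X ` {..<6} = {u, J u, z, br u z, br u (br u z), br (J u) z}" (is "_ = ?B")
    by (auto simp: X lessThan_nat_numeral lessThan_Suc numeral_eq_Suc X_def)
  have "lcs br 3 \<subseteq> span ?B"
    by (rule lcs_3_least[OF _ u], unfold z_def[symmetric])
      (auto simp: b03 intro: span_base span_zero)
  then have l2: "lcs br 2 \<subseteq> span ?B"
    by (intro lcs_2_least[OF subspace_span u, folded z_def]) (simp_all add: span_base)
  have l1: "x \<in> span ?B" if x: "x \<in> lcs br 1" for x
  proof -
    obtain c y where y: "y \<in> lcs br 2" "x = c *\<^sub>R z + y"
      using lcs_1_decomp'[OF u x] unfolding z_def .
    then show ?thesis using l2 by (auto intro!: span_add span_scale intro: span_base)
  qed
  have "v \<in> span ?B" for v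
  proof -
    obtain a b x where x: "x \<in> lcs br (Suc 0)" "v = a *\<^sub>R u + b *\<^sub>R J u + x"
      using generators[of u v] u unfolding One_nat_def by blast
    then show ?thesis using l1[of x] by (auto intro!: span_add span_scale intro: span_base)
  qed
  then have span: "span (X ` {..<6}) = UNIV" unfolding im by blast
  have br0: "br z (br u z) = 0" "br (br u z) z = 0" "br z (br (J u) z) = 0" "br (br (J u) z) z = 0"
    "br (br u z) (br (J u) z) = 0" "br (br (J u) z) (br u z) = 0"
    using br_lcs_1_1 br_lcs_0 z1 by blast+
  have br4: "br s (br u (br u z)) = 0" "br (br u (br u z)) s = 0" for s
    using br_lcs_3[OF m3] br_anti[of _ s] by simp_all
  have neg: "br (J u) u = - z" "br z u = - br u z" "br z (J u) = - br (J u) z"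
     "br (br u z) u = - br u (br u z)" "br (br (J u) z) u = 0" "br (br u z) (J u) = 0"
     "br (br (J u) z) (J u) = - br u (br u z)"
    using br_anti[of "J u" u] br_anti[of z u] br_anti[of z "J u"] br_anti[of "br u z" u]
      br_anti[of "br (J u) z" u] br_anti[of "br u z" "J u"] br_anti[of "br (J u) z" "J u"]
    by (simp_all add: b03 flip: z_def)
  show ?thesis
  proof (rule iso_to_structureI[OF DIM_eq span])
    fix i j :: nat assume "i < 6" "j < 6"
    then have ij: "i \<in> {0, 1, 2, 3, 4, 5}" "j \<in> {0, 1, 2, 3, 4, 5}" by auto
    have sum6: "(\<Sum>k<6. f k) = f 0 + f 1 + f 2 + f 3 + f 4 + f 5" for f :: "nat \<Rightarrow> 'a"
      by (simp add: numeral_eq_Suc)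
    show "br (X i) (X j) = (\<Sum>k<6. n63_sc i j k *\<^sub>R X k)"
      unfolding sum6 using ij
      by (elim insertE emptyE; hypsubst)
        (simp_all add: n63_sc_def sc_of_list_def X br0 br4 neg b03 flip: z_def)
  qed
qed

end

section \<open>Dimension four\<close>

lemma (in lie_alg) iso_L3R:
  assumes dim: "DIM('a) = 4" and L1: "dim (lcs br 1) = 1" and L2: "lcs br 2 = {0}"
  shows "iso_to_structure br 4 L3R_sc"
proof -
  have central: "br x y = 0" "br y x = 0" if "x \<in> lcs br 1" for x y
    using br_left_mem_lcs[of x 1] br_right_mem_lcs[of x 1] that L2 by (simp_all add: numeral_2_eq_2)
  have br1: "br x y \<in> lcs br 1" for x y
    using br_left_mem_lcs[of x 0] by simp
  have "\<exists>x y. br x y \<noteq> 0"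
  proof (rule ccontr)
    assume "\<not> ?thesis"
    then have "lcs br (Suc 0) \<subseteq> {0}" by (intro lcs_Suc_least) auto
    then have "dim (lcs br 1) = 0" by (simp add: dim_eq_0)
    then show False using L1 by linarith
  qed
  then obtain x y where w: "br x y \<noteq> 0" by blast
  define w where "w = br x y"
  have multiple: "\<exists>c. br a b = c *\<^sub>R w" for a b
  proof -
    have "dim (lcs br 1) \<le> dim {0::'a} + 1" using L1 by simp
    then obtain c where "br a b - c *\<^sub>R w \<in> {0}"
      using codim_one_subspace[of "{0}" "lcs br 1" w "br a b"] subspace_lcs br1 w
        subspace_0[OF subspace_lcs] unfolding w_def by auto
    then show ?thesis by auto
  qed
  have "dim {y, x, w} \<le> card {y, x, w}" by (rule dim_le_card') simp
  also have "\<dots> \<le> 3" by (simp add: card_insert_if)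
  finally have "dim (span {y, x, w}) \<noteq> DIM('a)" using dim by simp
  then have "span {y, x, w} \<noteq> UNIV" by (metis dim_UNIV)
  then obtain v0 where v0: "v0 \<notin> span {y, x, w}" by blast
  obtain a b where a: "br v0 y = a *\<^sub>R w" and b: "br x v0 = b *\<^sub>R w" using multiple by metis
  \<comment> \<open>The correction by \<open>x\<close> and \<open>y\<close> makes \<open>v\<close>
    commute with both, and it stays outside their span with \<open>w\<close>.\<close>
  define v where "v = v0 - a *\<^sub>R x - b *\<^sub>R y"
  have v: "v \<notin> span {y, x, w}"
  proof
    assume "v \<in> span {y, x, w}"
    then have "v + a *\<^sub>R x + b *\<^sub>R y \<in> span {y, x, w}"
      by (intro span_add span_scale) (auto intro: span_base)
    then show False using v0 by (simp add: v_def)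
  qed
  have vx: "br x v = 0" "br v x = 0" and vy: "br v y = 0" "br y v = 0"
    using a b br_anti[of v x] br_anti[of y v] by (simp_all add: v_def br_linear w_def)
  have cw: "br w s = 0" "br s w = 0" for s
    using central[OF br1] by (simp_all add: w_def)
  have x: "x \<notin> span {w}"
  proof
    assume "x \<in> span {w}"
    then obtain k where "x = k *\<^sub>R w" by (auto simp: span_singleton)
    then have "br x y = k *\<^sub>R br w y" by (metis br_linear(5))
    then show False using w cw by simp
  qed
  have y: "y \<notin> span {x, w}"
  proof
    assume "y \<in> span {x, w}"
    then obtain k m where "y - k *\<^sub>R x = m *\<^sub>R w"
      by (auto simp: span_breakdown_eq[of y x] span_singleton)
    then have "br x (y - k *\<^sub>R x) = br x (m *\<^sub>R w)" by (rule arg_cong)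
    then show False using w cw by (simp add: br_linear)
  qed
  define X where "X = (!) [x, y, w, v]"
  have im: "X ` {..<4} = {v, y, x, w}"
    by (auto simp: lessThan_Suc numeral_eq_Suc X_def)
  have "dim {v, y, x, w} = 4"
    using v x y w by (simp add: dim_insert w_def)
  then have span: "span (X ` {..<4}) = UNIV"
    unfolding im using dim by (metis dim_eq_full)
  show ?thesis
  proof (rule iso_to_structureI[OF dim span])
    fix i j :: nat assume "i < 4" "j < 4"
    then have ij: "i \<in> {0, 1, 2, 3}" "j \<in> {0, 1, 2, 3}" by auto
    have sum4: "(\<Sum>k<4. f k) = f 0 + f 1 + f 2 + f 3" for f :: "nat \<Rightarrow> 'a"
      by (simp add: numeral_eq_Suc)
    have "br y x = - w" using br_anti[of y x] by (simp add: w_def)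
    then show "br (X i) (X j) = (\<Sum>k<4. L3R_sc i j k *\<^sub>R X k)"
      unfolding sum4 using ij
      by (elim insertE emptyE; hypsubst)
        (simp_all add: L3R_sc_def sc_of_list_def X_def vx vy cw flip: w_def)
  qed
qed

section \<open>The final dimension counts\<close>

theorem theorem3:
  fixes br :: "'a::euclidean_space \<Rightarrow> 'a \<Rightarrow> 'a"
  assumes "lie_algebra br"
    and "quasi_filiform br"
    and "\<exists>J. complex_structure br J"
  shows "iso_to_structure br 4 L3R_sc \<or> iso_to_structure br 6 n63_sc"
proof -
  obtain J where J: "complex_structure br J" using assms(3) by blast
  define r where "r = nilindex br"
  have nil: "\<exists>m. lcs br m = {0}" and n: "DIM('a) = r + 2"
    using assms(2) by (auto simp: quasi_filiform_def nilpotent_lie_def r_def)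
  have "lcs br r = {0}"
    unfolding r_def nilindex_def by (rule LeastI_ex[OF nil])
  moreover have "lcs br k \<noteq> {0}" if "k < r" for k
    using not_less_Least[of k "\<lambda>m. lcs br m = {0}"] that by (simp add: r_def nilindex_def)
  ultimately interpret complex_nilpotent br r J
    using assms(1) J unfolding complex_structure_def
    by (intro complex_nilpotent.intro nilpotent_lie_alg.intro lie_alg.intro almost_complex.intro
        nilpotent_lie_alg_axioms.intro complex_nilpotent_axioms.intro)
      (auto simp: algebra_simps)
  have beyond: "dim (lcs br k) = 0" if "r \<le> k" for k
    using lcs_antimono[OF that] lcs_r by (simp add: dim_eq_0)
  have "r \<noteq> 0"
    using lcs_r n by (metis DIM_positive dim_UNIV dim_eq_0 lcs.simps(1) less_irrefl order_refl)
  moreover have "even r" using even_DIM n by simp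
  ultimately have r: "1 < r" by (metis One_nat_def Suc_lessI neq0_conv odd_one)
  have le: "dim (lcs br (Suc 0)) \<le> r"
    using dim_S_one dim_subset[OF lcs_subset_S[of "Suc 0"]] r n by simp
  show ?thesis
  proof (cases "dim (lcs br (Suc 0)) = r")
    case False
    \<comment> \<open>From g^1 on there is no slack. Past \<open>r\<close> both sides are zero,
      since subtraction truncates.\<close>
    then have *: "dim (lcs br (Suc j)) = r - Suc j" for j
      using le dim_lcs_eq[of "Suc 0" "Suc j"] r beyond[of "Suc j"] by (cases "Suc j \<le> r") auto
    \<comment> \<open>Only the first jump exceeds one, and \<open>dim_S_ge\<close> constrains just
      the jumps after it, so index 0 is allowed.\<close>
    have "2 * (r - 0) \<le> dim (S 0)" by (rule dim_S_ge) (simp_all add: *)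
    also have "\<dots> \<le> r + 2" using dim_subset_UNIV n by metis
    finally have "r = 2" using r by simp
    then show ?thesis using iso_L3R n *[of 0] lcs_r by simp
  next
    case True
    interpret two_generator_complex br r J
      using r True n by unfold_locales auto
    \<comment> \<open>The double jump from g^2 to g^3 uses up the surplus; all later jumps have size
      one, and \<open>dim_S_ge\<close> applies from index 2.\<close>
    have *: "dim (lcs br (Suc (Suc (Suc j)))) = r - Suc (Suc (Suc j))" for j
      using dim_lcs_2 dim_lcs_3 True dim_lcs_eq[of "Suc (Suc (Suc 0))" "Suc (Suc (Suc j))"]
        beyond[of "Suc (Suc (Suc j))"]
      by (cases "Suc (Suc (Suc j)) \<le> r") auto
    have "2 * (r - Suc (Suc 0)) \<le> dim (S (Suc (Suc 0)))"
    proof (rule dim_S_ge)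
      fix j assume "Suc (Suc 0) \<le> j"
      then obtain i where "j = Suc (Suc i)" by (metis Suc_le_D Suc_le_mono)
      then show "dim (lcs br (Suc j)) \<le> dim (lcs br (Suc (Suc j))) + 1" by (simp add: *)
    qed (use r in simp)
    then have "r \<le> 4" by (simp add: S_2_eq True)
    moreover have "3 \<le> r" using dim_lcs_2 dim_lcs_3 True by simp
    ultimately have r4: "r = 4" using \<open>even r\<close> by (cases "r = 3") auto
    interpret six_dim_complex br r J
      using r4 n dim_lcs_2 True *[of 0] by unfold_locales (simp_all add: numeral_eq_Suc)
    show ?thesis using iso_n63 by blast
  qed
qed

end
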